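(* Let $n\geq 2$, let $A=[a_{ij}]\in\mathcal{PC}_{n}$, let $A(n)\in\mathcal{PC}_{n-1}$ be the principal submatrix of $A$ obtained by deleting row $n$ and column $n$, and let $w=[w_1\ \cdots\ w_{n-1}]^{T}\in\mathcal{E}(A(n))$. Then, for a real scalar $x$, $$\begin{bmatrix} w\\ x\end{bmatrix}\in\mathcal{E}(A)$$ if and only if $$x\in\left[\min_{1\leq i\leq n-1}\frac{w_{i}}{a_{in}},\ \max_{1\leq i\leq n-1}\frac{w_{i}}{a_{in}}\right].$$
   Context: A reciprocal (pairwise comparison) matrix of order $n$ is an $n\times n$ real matrix $A=[a_{ij}]$ with all entries positive and $a_{ji}=1/a_{ij}$ for all $1\leq i,j\leq n$ (so its diagonal entries are $1$). The set of all such matrices is denoted $\mathcal{PC}_{n}$. A positive $n$-vector is a vector in $\mathbb{R}^n$ with all entries positive. For a positive $n$-vector $w=[w_1\ \cdots\ w_n]^T$, let $w^{(-T)}=[1/w_1\ \cdots\ 1/w_n]$ be the transpose of its entrywise inverse, so that $ww^{(-T)}=[w_i/w_j]$. For a matrix $B$, $|B|$ denotes the entrywise absolute value, and inequalities between matrices are entrywise. A positive $n$-vector $w$ is efficient for $A\in\mathcal{PC}_{n}$ if, for every positive $n$-vector $v$, the inequality $|vv^{(-T)}-A|\leq|ww^{(-T)}-A|$ implies that $v$ and $w$ are proportional. $\mathcal{E}(A)$ denotes the set of all (positive) vectors that are efficient for $A$. *)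

theory Defs
  imports "Jordan_Normal_Form.Determinant"
begin

text \<open>Vectors and matrices are those of \<^theory>\<open>Jordan_Normal_Form.Matrix\<close>, hence indices run
  over \<open>0, \<dots>, n - 1\<close>: the last row or column, index \<open>n\<close> on paper, has index \<open>n - 1\<close> here.\<close>

definition PC :: "nat \<Rightarrow> real mat set" where
  "PC n = {A \<in> carrier_mat n n. \<forall>i<n. \<forall>j<n. A $$ (i, j) > 0 \<and> A $$ (j, i) = 1 / A $$ (i, j)}"

definition pos_vecs :: "nat \<Rightarrow> real vec set" where
  "pos_vecs n = {w \<in> carrier_vec n. \<forall>i<n. w $ i > 0}"

text \<open>The matrix product of the column \<open>w\<close> and the row of the reciprocals of its entries.\<close>

definition ratio_mat :: "real vec \<Rightarrow> real mat" where
  "ratio_mat w = mat_of_cols (dim_vec w) [w] * mat_of_row (map_vec (\<lambda>t. 1 / t) w)"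

lemma ratio_mat_carrier [simp]: "w \<in> carrier_vec n \<Longrightarrow> ratio_mat w \<in> carrier_mat n n"
  by (auto simp: ratio_mat_def)

lemma ratio_mat_index:
  assumes "i < dim_vec w" "j < dim_vec w"
  shows "ratio_mat w $$ (i, j) = w $ i / w $ j"
  using assms by (simp add: ratio_mat_def scalar_prod_def mat_of_cols_index col_def)

abbreviation mat_abs :: "real mat \<Rightarrow> real mat" where
  "mat_abs B \<equiv> map_mat abs B"

definition proportional :: "real vec \<Rightarrow> real vec \<Rightarrow> bool" where
  "proportional v w \<longleftrightarrow> (\<exists>c. c \<noteq> 0 \<and> v = c \<cdot>\<^sub>v w)"

text \<open>The order \<open>\<le>\<close> on \<^typ>\<open>real mat\<close> is entrywise.\<close>

definition efficient_vecs :: "real mat \<Rightarrow> real vec set" where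
  "efficient_vecs A = {w \<in> pos_vecs (dim_row A). \<forall>v \<in> pos_vecs (dim_row A).
     mat_abs (ratio_mat v - A) \<le> mat_abs (ratio_mat w - A) \<longrightarrow> proportional v w}"

text \<open>Deleting the last row and column stays within the reciprocal matrices.\<close>

lemma PC_mat_delete_last:
  assumes "A \<in> PC n"
  shows "mat_delete A (n - 1) (n - 1) \<in> PC (n - 1)"
proof -
  let ?B = "mat_delete A (n - 1) (n - 1)"
  have A: "A \<in> carrier_mat n n"
    and rec: "\<And>i j. i < n \<Longrightarrow> j < n \<Longrightarrow> A $$ (i, j) > 0 \<and> A $$ (j, i) = 1 / A $$ (i, j)"
    using assms unfolding PC_def by blast+
  have B: "?B $$ (i, j) = A $$ (i, j)" if "i < n - 1" "j < n - 1" for i j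
    using A that by (simp add: mat_delete_def)
  have "?B $$ (i, j) > 0 \<and> ?B $$ (j, i) = 1 / ?B $$ (i, j)" if "i < n - 1" "j < n - 1" for i j
    unfolding B[OF that] B[OF that(2,1)] using that by (intro rec) linarith+
  moreover have "?B \<in> carrier_mat (n - 1) (n - 1)"
    using A by (rule mat_delete_carrier)
  ultimately show ?thesis
    unfolding PC_def by blast
qed

end

theory Submission
  imports Defs
begin

text \<open>Write \<open>r\<^sub>i = w\<^sub>i / a\<^sub>i\<^sub>n\<close>: this is the value of the last coordinate that reproduces the entries
  \<open>a\<^sub>i\<^sub>n\<close> and \<open>a\<^sub>n\<^sub>i\<close> exactly. Moving the last coordinate from \<open>x\<close> to \<open>y\<close> changes nothing in the
  leading block. It worsens neither of the entries \<open>(i, n)\<close> and \<open>(n, i)\<close> if \<open>y\<close> lies between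
  \<open>x\<close> and \<open>r\<^sub>i\<close>, and it worsens one of them if \<open>y\<close> lies on the other side of \<open>x\<close> than \<open>r\<^sub>i\<close>
  (\<open>between_imp_approximates\<close>, \<open>approximates_imp_le\<close>, \<open>approximates_imp_ge\<close>).

  If \<open>x\<close> is below all the \<open>r\<^sub>i\<close>, then replacing it by their minimum is an improvement, and likewise
  from above with their maximum; so an efficient extension has \<open>x\<close> between these bounds.
  Conversely, let \<open>x\<close> be between them and let \<open>v\<close> approximate \<open>A\<close> at least as well as the extension
  of \<open>w\<close> by \<open>x\<close>. Efficiency of \<open>w\<close> makes the leading part of \<open>v\<close> a multiple \<open>c w\<close>.
  An index with \<open>r\<^sub>i \<le> x\<close> forces \<open>v\<^sub>n / c \<le> x\<close> and an index with \<open>r\<^sub>j \<ge> x\<close>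
  forces \<open>v\<^sub>n / c \<ge> x\<close>, so all of \<open>v\<close> is \<open>c\<close> times the extension.\<close>

lemma between_imp_approximates:
  fixes a t x y :: real
  assumes "a > 0" "t > 0" "x > 0" "y > 0"
    and "x \<le> y \<and> y \<le> t / a \<or> t / a \<le> y \<and> y \<le> x"
  shows "\<bar>t / y - a\<bar> \<le> \<bar>t / x - a\<bar>" "\<bar>y / t - 1 / a\<bar> \<le> \<bar>x / t - 1 / a\<bar>"
proof -
  have "t / x \<ge> t / y \<and> t / y \<ge> a \<and> x / t \<le> y / t \<and> y / t \<le> 1 / a
      \<or> t / x \<le> t / y \<and> t / y \<le> a \<and> x / t \<ge> y / t \<and> y / t \<ge> 1 / a"
    using assms by (auto simp: field_simps)
  then show "\<bar>t / y - a\<bar> \<le> \<bar>t / x - a\<bar>" "\<bar>y / t - 1 / a\<bar> \<le> \<bar>x / t - 1 / a\<bar>"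
    by linarith+
qed

text \<open>The two entries bound \<open>y\<close> on different sides: the signs of \<open>t / x - a\<close> and \<open>x / t - 1 / a\<close>
  are opposite, and each error bounds its ratio from above when its sign is nonnegative.\<close>

lemma approximates_imp_le:
  fixes a t x y :: real
  assumes "a > 0" "t > 0" "t / a \<le> x" "\<bar>y / t - 1 / a\<bar> \<le> \<bar>x / t - 1 / a\<bar>"
  shows "y \<le> x"
proof -
  have "x / t \<ge> 1 / a" using assms(1-3) by (simp add: field_simps)
  then have "y / t \<le> x / t" using assms(4) by linarith
  then show ?thesis using \<open>t > 0\<close> by (simp add: divide_le_cancel)
qed

lemma approximates_imp_ge:
  fixes a t x y :: real
  assumes "a > 0" "t > 0" "x > 0" "y > 0" "x \<le> t / a" "\<bar>t / y - a\<bar> \<le> \<bar>t / x - a\<bar>"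
  shows "x \<le> y"
proof -
  have "t / x \<ge> a" using assms(1-3,5) by (simp add: field_simps)
  then have "t / y \<le> t / x" using assms(6) by linarith
  then show ?thesis using assms(2-4) by (simp add: field_simps)
qed

lemma PC_entry:
  assumes "A \<in> PC n" "i < n" "j < n"
  shows "A $$ (i, j) > 0" "A $$ (j, i) = 1 / A $$ (i, j)"
  using assms unfolding PC_def by blast+

lemma mem_efficient_vecs_iff:
  assumes "A \<in> carrier_mat n n"
  shows "w \<in> efficient_vecs A \<longleftrightarrow> w \<in> pos_vecs n \<and> (\<forall>v \<in> pos_vecs n.
    (\<forall>i<n. \<forall>j<n. \<bar>v $ i / v $ j - A $$ (i, j)\<bar> \<le> \<bar>w $ i / w $ j - A $$ (i, j)\<bar>)
      \<longrightarrow> proportional v w)"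
proof -
  have "mat_abs (ratio_mat v - A) \<le> mat_abs (ratio_mat w - A) \<longleftrightarrow>
      (\<forall>i<n. \<forall>j<n. \<bar>v $ i / v $ j - A $$ (i, j)\<bar> \<le> \<bar>w $ i / w $ j - A $$ (i, j)\<bar>)"
    if "v \<in> pos_vecs n" "w \<in> pos_vecs n" for v
  proof -
    have "v \<in> carrier_vec n" "w \<in> carrier_vec n" using that by (auto simp: pos_vecs_def)
    moreover from this have "ratio_mat v \<in> carrier_mat n n" "ratio_mat w \<in> carrier_mat n n"
      by simp_all
    ultimately show ?thesis
      using assms by (auto simp: less_eq_mat_def ratio_mat_index)
  qed
  then show ?thesis using assms unfolding efficient_vecs_def by auto
qed

text \<open>A constant of its own keeps the coordinates of the extended vector in the two cases below,
  instead of the case distinctions and index shifts of concatenation.\<close>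

definition snoc_vec :: "real vec \<Rightarrow> real \<Rightarrow> real vec" where
  "snoc_vec w x = w @\<^sub>v vec_of_list [x]"

lemma snoc_vec_carrier:
  assumes "w \<in> carrier_vec m"
  shows "snoc_vec w x \<in> carrier_vec (Suc m)"
  using assms unfolding snoc_vec_def by (intro carrier_vecI) simp

lemma snoc_vec_index:
  assumes "w \<in> carrier_vec m"
  shows "i < m \<Longrightarrow> snoc_vec w x $ i = w $ i" "snoc_vec w x $ m = x"
  using assms by (simp_all add: snoc_vec_def)

lemma snoc_vec_pos_iff:
  assumes "w \<in> pos_vecs m"
  shows "snoc_vec w x \<in> pos_vecs (Suc m) \<longleftrightarrow> x > 0"
proof -
  have w: "w \<in> carrier_vec m" "\<forall>i<m. w $ i > 0" using assms by (simp_all add: pos_vecs_def)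
  then show ?thesis
    by (simp add: pos_vecs_def All_less_Suc snoc_vec_carrier snoc_vec_index[OF w(1)])
qed

text \<open>Two extensions of the same vector differ at most in the row and column of the new index, so
  efficiency can be refuted by improving these entries. Nonemptiness of \<open>w\<close> makes the factor of
  proportionality equal to \<open>1\<close>.\<close>

lemma efficient_extension_unimprovable:
  assumes "A \<in> PC (Suc m)" "m > 0" "w \<in> pos_vecs m" "y > 0"
    and eff: "snoc_vec w x \<in> efficient_vecs A"
    and between: "\<And>i. i < m \<Longrightarrow>
      x \<le> y \<and> y \<le> w $ i / A $$ (i, m) \<or> w $ i / A $$ (i, m) \<le> y \<and> y \<le> x"
  shows "y = x"
proof -
  let ?u = "snoc_vec w"
  have A: "A \<in> carrier_mat (Suc m) (Suc m)" using assms(1) by (simp add: PC_def)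
  have w: "w \<in> carrier_vec m" and wpos: "\<And>i. i < m \<Longrightarrow> w $ i > 0"
    using assms(3) by (auto simp: pos_vecs_def)
  have "x > 0"
    using eff snoc_vec_pos_iff[OF assms(3)] by (simp add: mem_efficient_vecs_iff[OF A])
  have "\<bar>?u y $ i / ?u y $ j - A $$ (i, j)\<bar> \<le> \<bar>?u x $ i / ?u x $ j - A $$ (i, j)\<bar>"
    if "i < Suc m" "j < Suc m" for i j
  proof -
    have "\<bar>w $ k / y - A $$ (k, m)\<bar> \<le> \<bar>w $ k / x - A $$ (k, m)\<bar>"
      "\<bar>y / w $ k - A $$ (m, k)\<bar> \<le> \<bar>x / w $ k - A $$ (m, k)\<bar>" if "k < m" for k
      using between_imp_approximates[OF _ wpos[OF that] \<open>x > 0\<close> \<open>y > 0\<close> between[OF that]]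
        PC_entry[OF assms(1), of k m] that by simp_all
    then show ?thesis
      using that \<open>x > 0\<close> \<open>y > 0\<close>
      by (auto simp: less_Suc_eq snoc_vec_index[OF w])
  qed
  then have "proportional (?u y) (?u x)"
    using eff assms(3) \<open>y > 0\<close>
    by (simp add: mem_efficient_vecs_iff[OF A] snoc_vec_pos_iff)
  then obtain c where c: "?u y = c \<cdot>\<^sub>v ?u x" by (auto simp: proportional_def)
  have entry: "?u y $ i = c * ?u x $ i" if "i < Suc m" for i
    using that snoc_vec_carrier[OF w, of x] unfolding c by (subst index_smult_vec) auto
  have "w $ 0 = c * w $ 0"
    using entry[of 0] \<open>m > 0\<close> by (simp add: snoc_vec_index[OF w])
  then have "c = 1" using wpos[OF \<open>m > 0\<close>] by simp
  then show "y = x" using entry[of m] by (simp add: snoc_vec_index[OF w])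
qed

text \<open>A competitor \<open>v\<close> is at least as good on the leading block, so efficiency of \<open>w\<close> fixes its
  leading part up to a factor. The two hypotheses on \<open>x\<close> then pin its last entry: the index \<open>i\<close>
  keeps it from growing and the index \<open>j\<close> from shrinking.\<close>

lemma efficient_extension:
  assumes "A \<in> PC (Suc m)" "w \<in> efficient_vecs (mat_delete A m m)"
    and "i < m" "w $ i / A $$ (i, m) \<le> x" "j < m" "x \<le> w $ j / A $$ (j, m)"
  shows "snoc_vec w x \<in> efficient_vecs A"
proof -
  let ?u = "snoc_vec w x" and ?B = "mat_delete A m m"
  have A: "A \<in> carrier_mat (Suc m) (Suc m)" using assms(1) by (simp add: PC_def)
  then have B: "?B \<in> carrier_mat m m" using mat_delete_carrier[of A "Suc m" "Suc m" m m] by simp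
  have B_entry: "?B $$ (k, l) = A $$ (k, l)" if "k < m" "l < m" for k l
    using A that by (simp add: mat_delete_def)
  have wP: "w \<in> pos_vecs m" using assms(2) by (simp add: mem_efficient_vecs_iff[OF B])
  then have w: "w \<in> carrier_vec m" and wpos: "\<And>k. k < m \<Longrightarrow> w $ k > 0"
    by (auto simp: pos_vecs_def)
  note u_index = snoc_vec_index[OF w]
  have apos: "A $$ (k, m) > 0" if "k < m" for k
    using PC_entry(1)[OF assms(1)] that by simp
  have "w $ i / A $$ (i, m) > 0" using wpos apos assms(3) by simp
  then have "x > 0" using assms(4) by linarith
  have "proportional v ?u"
    if v: "v \<in> pos_vecs (Suc m)"
      and le: "\<forall>k<Suc m. \<forall>l<Suc m. \<bar>v $ k / v $ l - A $$ (k, l)\<bar> \<le> \<bar>?u $ k / ?u $ l - A $$ (k, l)\<bar>"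
    for v
  proof -
    have vc: "v \<in> carrier_vec (Suc m)" and vpos: "\<And>k. k < Suc m \<Longrightarrow> v $ k > 0"
      using v by (auto simp: pos_vecs_def)
    define v' where "v' = vec m (\<lambda>k. v $ k)"
    have "v' \<in> pos_vecs m" using vpos by (simp add: v'_def pos_vecs_def)
    moreover have "\<bar>v' $ k / v' $ l - ?B $$ (k, l)\<bar> \<le> \<bar>w $ k / w $ l - ?B $$ (k, l)\<bar>"
      if "k < m" "l < m" for k l
      using le[rule_format, of k l] that
      by (simp add: v'_def B_entry u_index)
    ultimately have "proportional v' w"
      using assms(2) by (simp add: mem_efficient_vecs_iff[OF B])
    then obtain c where "v' = c \<cdot>\<^sub>v w" by (auto simp: proportional_def)
    then have vk: "v $ k = c * w $ k" if "k < m" for k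
      using that w by (metis carrier_vecD index_smult_vec(1) index_vec v'_def)
    have "c > 0" using vk[OF assms(3)] vpos[of i] wpos[OF assms(3)] assms(3)
      by (simp add: zero_less_mult_iff)
    (* Ratios do not see the factor c, so v may be compared as the extension of w by y. *)
    define y where "y = v $ m / c"
    have "y > 0" using vpos[of m] \<open>c > 0\<close> by (simp add: y_def)
    have vm: "v $ m = c * y" using \<open>c > 0\<close> by (simp add: y_def)
    have "\<bar>w $ k / y - A $$ (k, m)\<bar> \<le> \<bar>w $ k / x - A $$ (k, m)\<bar>"
      "\<bar>y / w $ k - 1 / A $$ (k, m)\<bar> \<le> \<bar>x / w $ k - 1 / A $$ (k, m)\<bar>" if "k < m" for k
      using le[rule_format, of k m] le[rule_format, of m k] that \<open>c > 0\<close>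
        PC_entry(2)[OF assms(1), of k m]
      by (simp_all add: vk vm u_index)
    then have "y \<le> x" "x \<le> y"
      using approximates_imp_le[OF apos wpos assms(4)] assms(3)
        approximates_imp_ge[OF apos wpos \<open>x > 0\<close> \<open>y > 0\<close> assms(6)] assms(5) by blast+
    then have "v = c \<cdot>\<^sub>v ?u"
      using vc snoc_vec_carrier[OF w, of x] by (intro eq_vecI) (auto simp: less_Suc_eq vk vm u_index)
    then show ?thesis using \<open>c > 0\<close> unfolding proportional_def by (intro exI[of _ c]) simp
  qed
  then show ?thesis
    using snoc_vec_pos_iff[OF wP] \<open>x > 0\<close> by (simp add: mem_efficient_vecs_iff[OF A])
qed

theorem theorem7:
  fixes n :: nat and A :: "real mat" and w :: "real vec" and x :: real
  assumes "n \<ge> 2"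
    and "A \<in> PC n"
    and "w \<in> efficient_vecs (mat_delete A (n - 1) (n - 1))"
  shows "w @\<^sub>v vec_of_list [x] \<in> efficient_vecs A \<longleftrightarrow>
    x \<in> {(MIN i\<in>{..<n - 1}. w $ i / A $$ (i, n - 1)) .. (MAX i\<in>{..<n - 1}. w $ i / A $$ (i, n - 1))}"
proof -
  define m where "m = n - 1"
  define r where "r i = w $ i / A $$ (i, m)" for i
  have "m > 0" and A: "A \<in> PC (Suc m)" and w: "w \<in> efficient_vecs (mat_delete A m m)"
    using assms by (simp_all add: m_def)
  have "mat_delete A m m \<in> carrier_mat m m"
    using PC_mat_delete_last[OF assms(2)] by (simp add: PC_def m_def)
  then have wP: "w \<in> pos_vecs m" using w by (simp add: mem_efficient_vecs_iff)
  have r_pos: "r i > 0" if "i < m" for i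
    using that wP PC_entry(1)[OF A] by (simp add: r_def pos_vecs_def)
  define lo hi where "lo = Min (r ` {..<m})" and "hi = Max (r ` {..<m})"
  have ne: "finite (r ` {..<m})" "r ` {..<m} \<noteq> {}" using \<open>m > 0\<close> by auto
  from Min_in[OF ne] obtain p where p: "p < m" "lo = r p" by (auto simp: lo_def)
  from Max_in[OF ne] obtain q where q: "q < m" "hi = r q" by (auto simp: hi_def)
  have bounds: "lo \<le> r i" "r i \<le> hi" if "i < m" for i
    using that by (simp_all add: lo_def hi_def)
  have "snoc_vec w x \<in> efficient_vecs A \<longleftrightarrow> lo \<le> x \<and> x \<le> hi"
  proof
    assume eff: "snoc_vec w x \<in> efficient_vecs A"
    note unimprovable = efficient_extension_unimprovable[OF A \<open>m > 0\<close> wP _ eff, folded r_def]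
    have "lo = x" if "x < lo"
      using that r_pos p bounds by (intro unimprovable) auto
    moreover have "hi = x" if "hi < x"
      using that r_pos q bounds by (intro unimprovable) auto
    ultimately show "lo \<le> x \<and> x \<le> hi" by force
  next
    assume "lo \<le> x \<and> x \<le> hi"
    then show "snoc_vec w x \<in> efficient_vecs A"
      using efficient_extension[OF A w p(1) _ q(1)] p q by (simp add: r_def)
  qed
  then show ?thesis by (simp add: lo_def hi_def r_def m_def snoc_vec_def)
qed

end
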